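(* Let $G$ be a circuit with leaves labeled by literals over $\mathbf{I}$ and $\mathbf{X}=(x_1,\dots,x_m)$, and let $\Psi(\mathbf{I})=(\psi_1(\mathbf{I}),\dots,\psi_m(\mathbf{I}))$ be a Skolem function vector for $\mathbf{X}$ in $\varphi_G(\mathbf{X},\mathbf{I})$. Let $G'$ be the circuit obtained from $G$ by replacing every leaf labeled $x_i$ by a circuit for $\psi_i(\mathbf{I})$ and every leaf labeled $\neg x_i$ by a circuit for $\neg\psi_i(\mathbf{I})$, so that $\varphi_{G'}(\mathbf{I})=\varphi_G(\Psi(\mathbf{I}),\mathbf{I})$. Let $F$ be the circuit representing $\bigwedge_{i=1}^m\big((x_i\wedge\psi_i(\mathbf{I}))\vee(\neg x_i\wedge\neg\psi_i(\mathbf{I}))\big)$, and let $H$ be the circuit representing $(\varphi_F\vee\varphi_G)\wedge\varphi_{G'}$. Then $H$ is in SAUNF with respect to $\mathrm{set}(\mathbf{X})$ and some sequence of literal-consistent sets of leaves, and $\varphi_G(\mathbf{X},\mathbf{I})\Leftrightarrow\varphi_H(\mathbf{X},\mathbf{I})$.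
   Context: Boolean values are $\bot,\top$. $\mathbf{I}$ (system inputs) and $\mathbf{X}$ (system outputs) are disjoint sequences of Boolean variables; $\mathrm{set}(\mathbf{V})$ is the set of variables of $\mathbf{V}$. A circuit is an NNF circuit: a rooted DAG whose nodes are all descendants of the root, internal nodes labeled $\wedge$ or $\vee$ with exactly two children, leaves labeled by literals or constants $\top,\bot$ (labels may repeat); negations of subformulas are represented by equivalent NNF circuits. $\varphi_G$ is the represented formula, $[\![\varphi_G]\!]$ its Boolean function. An $\ell$-leaf is a leaf labeled $\ell$; a set of leaves is literal-consistent if all carry the same literal. $G|_{L:b}$ relabels each leaf in $L$ by $b$; $G|_{\ell_1=b_1,\dots}$ relabels all $\ell_j$-leaves by $b_j$ ($\ell$ and $\neg\ell$ are distinct). $[\![\varphi]\!]_\sigma$ denotes substitution of an assignment $\sigma$. For a literal $\ell$ labeling a leaf of $G$ with variable $v_\ell$ and fresh $w,w'$: $\ell$ is $\wedge$-realizable in $G$ iff some assignment $\sigma$ of $(\mathrm{set}(\mathbf{I})\cup\mathrm{set}(\mathbf{X}))\setminus\{v_\ell\}$ gives $[\![G|_{\ell=w,\neg\ell=w'}]\!]_\sigma=[\![w\wedge w']\!]$, else $\wedge$-unrealizable. A literal-consistent set $S$ of $\ell$-leaves, with $S'$ all $\ell$-leaves, is $\wedge$-(un)realizable in $G$ iff $\ell$ is $\wedge$-(un)realizable in $G|_{S'\setminus S:\bot}$. $G$ is in SAUNF w.r.t. $\mathrm{set}(\mathbf{X})$ and a non-empty sequence $S=(S_1,\dots,S_k)$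 of leaf sets iff: the $S_j$ are pairwise disjoint; each $S_j$ is literal-consistent with a literal over $\mathbf{X}$; $S_1$ is $\wedge$-unrealizable in $G$; for $2\le j\le k$, $S_j$ is $\wedge$-unrealizable in $G|_{S_1:\top,\dots,S_{j-1}:\top}$; and $[\![\varphi_{G|_{S_1:\top,\dots,S_k:\top}}]\!]$ does not depend on $\mathbf{X}$. A Skolem function vector for $\mathbf{X}$ in $\varphi_G(\mathbf{X},\mathbf{I})$ is a sequence of circuits $\psi_i(\mathbf{I})$ over $\mathbf{I}$ with $\forall\mathbf{I}\,(\varphi_G(\Psi(\mathbf{I}),\mathbf{I})\Leftrightarrow\exists\mathbf{X}\varphi_G(\mathbf{X},\mathbf{I}))$. *)

theory Defs
  imports Main
begin

section \<open>NNF circuits\<close>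

datatype 'v lit = Pos 'v | Neg 'v

fun lit_var :: "'v lit \<Rightarrow> 'v" where
  "lit_var (Pos v) = v"
| "lit_var (Neg v) = v"

fun lit_neg :: "'v lit \<Rightarrow> 'v lit" where
  "lit_neg (Pos v) = Neg v"
| "lit_neg (Neg v) = Pos v"

fun lit_val :: "('v \<Rightarrow> bool) \<Rightarrow> 'v lit \<Rightarrow> bool" where
  "lit_val \<sigma> (Pos v) = \<sigma> v"
| "lit_val \<sigma> (Neg v) = (\<not> \<sigma> v)"

datatype 'v label = And | Or | Lit "'v lit" | Const bool

record ('n, 'v) circuit =
  nodes :: "'n set"
  edges :: "('n \<times> 'n) set"
  root :: "'n"
  label :: "'n \<Rightarrow> 'v label"

definition children :: "('n, 'v) circuit \<Rightarrow> 'n \<Rightarrow> 'n set" where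
  "children G n = edges G `` {n}"

definition is_circuit :: "('n, 'v) circuit \<Rightarrow> bool" where
  "is_circuit G \<longleftrightarrow>
     finite (nodes G) \<and> root G \<in> nodes G \<and> edges G \<subseteq> nodes G \<times> nodes G \<and> acyclic (edges G) \<and>
     (\<forall>n \<in> nodes G. (root G, n) \<in> (edges G)\<^sup>*) \<and>
     (\<forall>n \<in> nodes G. if label G n \<in> {And, Or} then card (children G n) = 2
                                           else children G n = {})"

definition circuit_over :: "'v set \<Rightarrow> ('n, 'v) circuit \<Rightarrow> bool" where
  "circuit_over V G \<longleftrightarrow>
     is_circuit G \<and> (\<forall>n \<in> nodes G. \<forall>l. label G n = Lit l \<longrightarrow> lit_var l \<in> V)"

text \<open>The value of the formula represented by a node. As the graph is acyclic and gates are
  monotone in their children, the least fixed point is the usual bottom-up evaluation.\<close>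

inductive holds :: "('n, 'v) circuit \<Rightarrow> ('v \<Rightarrow> bool) \<Rightarrow> 'n \<Rightarrow> bool"
  for G :: "('n, 'v) circuit" and \<sigma> :: "'v \<Rightarrow> bool"
where
  holds_Lit: "label G n = Lit l \<Longrightarrow> lit_val \<sigma> l \<Longrightarrow> holds G \<sigma> n"
| holds_Const: "label G n = Const True \<Longrightarrow> holds G \<sigma> n"
| holds_And: "label G n = And \<Longrightarrow> (\<And>c. c \<in> children G n \<Longrightarrow> holds G \<sigma> c) \<Longrightarrow> holds G \<sigma> n"
| holds_Or: "label G n = Or \<Longrightarrow> c \<in> children G n \<Longrightarrow> holds G \<sigma> c \<Longrightarrow> holds G \<sigma> n"

text \<open>The Boolean function of a circuit. Assignments are total on the type of variables; only the
  values of variables labelling leaves matter.\<close>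

definition eval_circuit :: "('n, 'v) circuit \<Rightarrow> ('v \<Rightarrow> bool) \<Rightarrow> bool" where
  "eval_circuit G \<sigma> \<longleftrightarrow> holds G \<sigma> (root G)"


section \<open>Relabelling leaves, realizability and SAUNF\<close>

definition lit_leaves :: "('n, 'v) circuit \<Rightarrow> 'v lit \<Rightarrow> 'n set" where
  "lit_leaves G l = {n \<in> nodes G. label G n = Lit l}"

definition relabel :: "('n, 'v) circuit \<Rightarrow> 'n set \<Rightarrow> bool \<Rightarrow> ('n, 'v) circuit" where
  "relabel G L b = G\<lparr>label := (\<lambda>n. if n \<in> L then Const b else label G n)\<rparr>"

definition relabel_lit :: "('n, 'v) circuit \<Rightarrow> 'v lit \<Rightarrow> bool \<Rightarrow> ('n, 'v) circuit" where
  "relabel_lit G l b = relabel G (lit_leaves G l) b"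

text \<open>The fresh variables \<open>w\<close> and \<open>w'\<close> range over their Boolean values, so that the identity of
  Boolean functions of \<open>w\<close>, \<open>w'\<close> is stated pointwise. The variable of \<open>l\<close> no longer labels a leaf
  after the relabelling, so its value under \<open>\<sigma>\<close> is irrelevant.\<close>

definition and_realizable :: "('n, 'v) circuit \<Rightarrow> 'v lit \<Rightarrow> bool" where
  "and_realizable G l \<longleftrightarrow>
     (\<exists>\<sigma>. \<forall>w w'. eval_circuit (relabel_lit (relabel_lit G l w) (lit_neg l) w') \<sigma> = (w \<and> w'))"

definition and_realizable_set :: "('n, 'v) circuit \<Rightarrow> 'v lit \<Rightarrow> 'n set \<Rightarrow> bool" where
  "and_realizable_set G l L \<longleftrightarrow> and_realizable (relabel G (lit_leaves G l - L) False) l"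

definition independent_of :: "'v set \<Rightarrow> ('n, 'v) circuit \<Rightarrow> bool" where
  "independent_of V G \<longleftrightarrow>
     (\<forall>\<sigma> \<tau>. (\<forall>v. v \<notin> V \<longrightarrow> \<sigma> v = \<tau> v) \<longrightarrow> eval_circuit G \<sigma> = eval_circuit G \<tau>)"

text \<open>The leaf sets are required to be non-empty: realizability is a property of literals that label
  some leaf, and the literal of a leaf set has to be determined by the set.\<close>

definition saunf :: "'v set \<Rightarrow> ('n, 'v) circuit \<Rightarrow> 'n set list \<Rightarrow> bool" where
  "saunf V G S \<longleftrightarrow>
     S \<noteq> [] \<and>
     (\<forall>i < length S. \<forall>j < length S. i \<noteq> j \<longrightarrow> S ! i \<inter> S ! j = {}) \<and>
     (\<forall>j < length S. \<exists>l. lit_var l \<in> V \<and> S ! j \<noteq> {} \<and> S ! j \<subseteq> lit_leaves G l \<and>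
        \<not> and_realizable_set (relabel G (\<Union> (set (take j S))) True) l (S ! j)) \<and>
     independent_of V (relabel G (\<Union> (set S)) True)"


section \<open>Skolem functions\<close>

definition subst_assignment ::
    "'v list \<Rightarrow> ('n, 'v) circuit list \<Rightarrow> ('v \<Rightarrow> bool) \<Rightarrow> 'v \<Rightarrow> bool" where
  "subst_assignment Xs \<Psi> \<sigma> v =
     (case map_of (zip Xs \<Psi>) v of None \<Rightarrow> \<sigma> v | Some C \<Rightarrow> eval_circuit C \<sigma>)"

definition skolem_vector ::
    "'v list \<Rightarrow> 'v list \<Rightarrow> ('m, 'v) circuit \<Rightarrow> ('n, 'v) circuit list \<Rightarrow> bool" where
  "skolem_vector Is Xs G \<Psi> \<longleftrightarrow>
     length \<Psi> = length Xs \<and>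
     (\<forall>C \<in> set \<Psi>. circuit_over (set Is) C) \<and>
     (\<forall>\<sigma>. eval_circuit G (subst_assignment Xs \<Psi> \<sigma>) \<longleftrightarrow>
          (\<exists>\<tau>. (\<forall>v. v \<notin> set Xs \<longrightarrow> \<tau> v = \<sigma> v) \<and> eval_circuit G \<tau>))"

definition negation_vector ::
    "'v list \<Rightarrow> ('n, 'v) circuit list \<Rightarrow> ('n, 'v) circuit list \<Rightarrow> bool" where
  "negation_vector Is \<Psi> N \<longleftrightarrow>
     list_all2 (\<lambda>C D. circuit_over (set Is) D \<and> (\<forall>\<sigma>. eval_circuit D \<sigma> \<longleftrightarrow> \<not> eval_circuit C \<sigma>)) \<Psi> N"


section \<open>Building circuits\<close>

text \<open>Node names for composed circuits: \<open>Base n\<close> is a node \<open>n\<close> of a given circuit, \<open>At n p\<close> is the node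
  \<open>p\<close> of the copy of a circuit replacing the leaf \<open>n\<close>, \<open>Top\<close> is a new root, and \<open>InL\<close>, \<open>InR\<close> tag the
  nodes of the two operands of a gate. Operands are thus always node-disjoint copies; in
  particular, their leaves are not shared.\<close>

datatype 'n node = Base 'n | At 'n 'n | Top | InL "'n node" | InR "'n node"

definition base_circuit :: "('n, 'v) circuit \<Rightarrow> ('n node, 'v) circuit" where
  "base_circuit G =
     \<lparr>nodes = Base ` nodes G,
      edges = {(Base m, Base n) | m n. (m, n) \<in> edges G},
      root = Base (root G),
      label = (\<lambda>a. case a of Base n \<Rightarrow> label G n | _ \<Rightarrow> Const False)\<rparr>"

definition leaf_circuit :: "'v label \<Rightarrow> ('n node, 'v) circuit" where
  "leaf_circuit lab = \<lparr>nodes = {Top}, edges = {}, root = Top, label = (\<lambda>_. lab)\<rparr>"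

definition gate_circuit ::
    "'v label \<Rightarrow> ('n node, 'v) circuit \<Rightarrow> ('n node, 'v) circuit \<Rightarrow> ('n node, 'v) circuit" where
  "gate_circuit lab A B =
     \<lparr>nodes = {Top} \<union> InL ` nodes A \<union> InR ` nodes B,
      edges = {(Top, InL (root A)), (Top, InR (root B))} \<union>
              {(InL m, InL n) | m n. (m, n) \<in> edges A} \<union>
              {(InR m, InR n) | m n. (m, n) \<in> edges B},
      root = Top,
      label = (\<lambda>a. case a of Top \<Rightarrow> lab | InL n \<Rightarrow> label A n | InR n \<Rightarrow> label B n | _ \<Rightarrow> Const False)\<rparr>"

abbreviation and_circuit ::
    "('n node, 'v) circuit \<Rightarrow> ('n node, 'v) circuit \<Rightarrow> ('n node, 'v) circuit" where
  "and_circuit \<equiv> gate_circuit And"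

abbreviation or_circuit ::
    "('n node, 'v) circuit \<Rightarrow> ('n node, 'v) circuit \<Rightarrow> ('n node, 'v) circuit" where
  "or_circuit \<equiv> gate_circuit Or"

fun big_and_circuit :: "('n node, 'v) circuit list \<Rightarrow> ('n node, 'v) circuit" where
  "big_and_circuit [] = leaf_circuit (Const True)"
| "big_and_circuit [C] = C"
| "big_and_circuit (C # D # Cs) = and_circuit C (big_and_circuit (D # Cs))"

text \<open>Each leaf labelled by a literal \<open>l\<close> with \<open>\<rho> l = Some C\<close> is replaced by its own copy of \<open>C\<close>.\<close>

definition replacement ::
    "('n, 'v) circuit \<Rightarrow> ('v lit \<Rightarrow> ('n, 'v) circuit option) \<Rightarrow> 'n \<Rightarrow> ('n, 'v) circuit option" where
  "replacement G \<rho> n = (case label G n of Lit l \<Rightarrow> \<rho> l | _ \<Rightarrow> None)"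

definition replaced_node ::
    "('n, 'v) circuit \<Rightarrow> ('v lit \<Rightarrow> ('n, 'v) circuit option) \<Rightarrow> 'n \<Rightarrow> 'n node" where
  "replaced_node G \<rho> n = (case replacement G \<rho> n of None \<Rightarrow> Base n | Some C \<Rightarrow> At n (root C))"

definition replace_leaves ::
    "('n, 'v) circuit \<Rightarrow> ('v lit \<Rightarrow> ('n, 'v) circuit option) \<Rightarrow> ('n node, 'v) circuit" where
  "replace_leaves G \<rho> =
     \<lparr>nodes = {Base n | n. n \<in> nodes G \<and> replacement G \<rho> n = None} \<union>
              {At n p | n p C. n \<in> nodes G \<and> replacement G \<rho> n = Some C \<and> p \<in> nodes C},
      edges = {(replaced_node G \<rho> m, replaced_node G \<rho> n) | m n. (m, n) \<in> edges G} \<union>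
              {(At n p, At n q) | n p q C.
                 n \<in> nodes G \<and> replacement G \<rho> n = Some C \<and> (p, q) \<in> edges C},
      root = replaced_node G \<rho> (root G),
      label = (\<lambda>a. case a of
                 Base n \<Rightarrow> label G n
               | At n p \<Rightarrow> (case replacement G \<rho> n of Some C \<Rightarrow> label C p | None \<Rightarrow> Const False)
               | _ \<Rightarrow> Const False)\<rparr>"

text \<open>In the following, the \<open>i\<close>-th entry of \<open>N\<close> is an NNF circuit for the negation of the \<open>i\<close>-th
  entry of \<open>\<Psi>\<close>.\<close>

fun skolem_replacement ::
    "'v list \<Rightarrow> ('n, 'v) circuit list \<Rightarrow> ('n, 'v) circuit list \<Rightarrow>
     'v lit \<Rightarrow> ('n, 'v) circuit option" where
  "skolem_replacement Xs \<Psi> N (Pos v) = map_of (zip Xs \<Psi>) v"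
| "skolem_replacement Xs \<Psi> N (Neg v) = map_of (zip Xs N) v"

definition skolem_subst_circuit ::
    "('n, 'v) circuit \<Rightarrow> 'v list \<Rightarrow> ('n, 'v) circuit list \<Rightarrow> ('n, 'v) circuit list \<Rightarrow>
     ('n node, 'v) circuit" where
  "skolem_subst_circuit G Xs \<Psi> N = replace_leaves G (skolem_replacement Xs \<Psi> N)"

definition skolem_graph_circuit ::
    "'v list \<Rightarrow> ('n, 'v) circuit list \<Rightarrow> ('n, 'v) circuit list \<Rightarrow> ('n node, 'v) circuit" where
  "skolem_graph_circuit Xs \<Psi> N =
     big_and_circuit
       (map (\<lambda>i. or_circuit
                   (and_circuit (leaf_circuit (Lit (Pos (Xs ! i)))) (base_circuit (\<Psi> ! i)))
                   (and_circuit (leaf_circuit (Lit (Neg (Xs ! i)))) (base_circuit (N ! i))))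
          [0..<length Xs])"

end

theory Submission
  imports Defs
begin

text \<open>The leaf sets are the singletons of the literal leaves of \<open>F\<close>, taken in the order
  \<open>x\<^sub>1, \<not>x\<^sub>1, x\<^sub>2, \<not>x\<^sub>2, \<dots>\<close>. Once all of them are set to true, every conjunct of \<open>F\<close> becomes
  \<open>\<psi>\<^sub>i \<or> \<not>\<psi>\<^sub>i\<close>, so \<open>H\<close> is equivalent to \<open>G'\<close>, which contains no system output. Suppose that at some
  step the value of \<open>H\<close> were \<open>w \<and> w'\<close>, where \<open>w\<close> labels the current leaf. The \<open>G\<close>-part does not
  depend on \<open>w\<close>, so comparing \<open>(w, w') = (1, 1)\<close> with \<open>(0, 1)\<close> shows that \<open>G'\<close> holds and that \<open>F\<close>
  changes from true to false. For a positive leaf the current conjunct is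
  \<open>(w \<and> \<psi>\<^sub>i) \<or> (w' \<and> \<not>\<psi>\<^sub>i)\<close>, so \<open>\<psi>\<^sub>i\<close> holds; for a negative leaf it is \<open>\<psi>\<^sub>i \<or> (w \<and> \<not>\<psi>\<^sub>i)\<close>,
  which does not contain \<open>w'\<close>. In both cases \<open>F\<close>, and hence \<open>H\<close>, is still true at \<open>(1, 0)\<close>.\<close>

section \<open>Evaluation\<close>

lemma holds_And_iff: "label G n = And \<Longrightarrow> holds G \<sigma> n \<longleftrightarrow> (\<forall>c \<in> children G n. holds G \<sigma> c)"
  by (auto elim: holds.cases intro: holds_And)

lemma holds_Or_iff: "label G n = Or \<Longrightarrow> holds G \<sigma> n \<longleftrightarrow> (\<exists>c \<in> children G n. holds G \<sigma> c)"
  by (auto elim: holds.cases intro: holds_Or)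

lemma holds_Lit_iff: "label G n = Lit l \<Longrightarrow> holds G \<sigma> n \<longleftrightarrow> lit_val \<sigma> l"
  by (auto elim: holds.cases intro: holds_Lit)

lemma holds_Const_iff: "label G n = Const b \<Longrightarrow> holds G \<sigma> n \<longleftrightarrow> b"
  by (cases b) (auto elim: holds.cases intro: holds_Const)

text \<open>The two directions are separate rule inductions, one on \<open>holds B\<close> and one
  on \<open>holds A\<close>. The disjunction in the premise lets a node be settled either by a value
  already known or by recursion through a gate, so that \<open>f\<close> may send a leaf of
  \<open>A\<close> to the root of a whole subcircuit of \<open>B\<close>.\<close>

lemma holds_transfer:
  assumes step: "\<And>n. n \<in> D \<Longrightarrow> (holds B \<sigma> (f n) \<longleftrightarrow> holds A \<tau> n) \<or>
      (label A n \<in> {And, Or} \<and> label B (f n) = label A n \<and>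
       children B (f n) = f ` children A n \<and> children A n \<subseteq> D)"
    and "n \<in> D"
  shows "holds B \<sigma> (f n) \<longleftrightarrow> holds A \<tau> n"
proof
  have "b = f n \<Longrightarrow> n \<in> D \<Longrightarrow> holds A \<tau> n" if "holds B \<sigma> b" for b n
    using that
  proof (induction arbitrary: n)
    case (holds_Lit b l)
    then show ?case using step[of n] holds.holds_Lit[of B b l \<sigma>] by auto
  next
    case (holds_Const b)
    then show ?case using step[of n] holds.holds_Const[of B b \<sigma>] by auto
  next
    case (holds_And b)
    have "holds B \<sigma> b" using holds_And(1,2) by (rule holds.holds_And)
    then show ?case
      using step[of n] holds_And(3,4,5) \<open>label B b = And\<close> by (fastforce simp: holds_And_iff)
  next
    case (holds_Or b c)
    have "holds B \<sigma> b" using holds_Or(1-3) by (rule holds.holds_Or)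
    then show ?case
      using step[of n] holds_Or(2-6) \<open>label B b = Or\<close> by (fastforce simp: holds_Or_iff)
  qed
  then show "holds B \<sigma> (f n) \<Longrightarrow> holds A \<tau> n" using \<open>n \<in> D\<close> by blast
next
  show "holds B \<sigma> (f n)" if "holds A \<tau> n"
    using that \<open>n \<in> D\<close>
  proof (induction)
    case (holds_Lit n l)
    then show ?case using step[of n] holds.holds_Lit[of A n l \<tau>] by auto
  next
    case (holds_Const n)
    then show ?case using step[of n] holds.holds_Const[of A n \<tau>] by auto
  next
    case (holds_And n)
    have "holds A \<tau> n" using holds_And(1,2) by (rule holds.holds_And)
    then show ?case
      using step[of n] holds_And by (fastforce simp: holds_And_iff)
  next
    case (holds_Or n c)
    have "holds A \<tau> n" using holds_Or(1-3) by (rule holds.holds_Or)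
    then show ?case
      using step[of n] holds_Or by (fastforce simp: holds_Or_iff)
  qed
qed

text \<open>The instance of \<open>holds_transfer\<close> for plain copies: leaves are settled by
  their value, gates by recursion. It identifies an operand with its copy inside a composed
  circuit.\<close>

lemma holds_embed:
  assumes "\<And>n. n \<in> D \<Longrightarrow> label B (f n) = label A n"
    and "\<And>n. n \<in> D \<Longrightarrow> children B (f n) = f ` children A n"
    and "\<And>n. n \<in> D \<Longrightarrow> children A n \<subseteq> D"
    and "\<And>n l. n \<in> D \<Longrightarrow> label A n = Lit l \<Longrightarrow> lit_val \<sigma> l = lit_val \<tau> l"
    and "n \<in> D"
  shows "holds B \<sigma> (f n) \<longleftrightarrow> holds A \<tau> n"
proof (rule holds_transfer[where D = D, OF _ \<open>n \<in> D\<close>])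
  fix n assume "n \<in> D"
  with assms(1-4)[of n]
  show "(holds B \<sigma> (f n) \<longleftrightarrow> holds A \<tau> n) \<or>
      (label A n \<in> {And, Or} \<and> label B (f n) = label A n \<and>
       children B (f n) = f ` children A n \<and> children A n \<subseteq> D)"
    by (cases "label A n") (auto simp: holds_Lit_iff holds_Const_iff)
qed

text \<open>Relabelled circuits are written as label updates throughout. This removes an update that
  changes nothing on the nodes; with \<open>g = label C\<close> it says that the value depends only
  on the variables in \<open>V\<close>.\<close>

lemma eval_circuit_cong:
  assumes "circuit_over V C" and "\<And>v. v \<in> V \<Longrightarrow> \<sigma> v = \<tau> v"
    and "\<And>n. n \<in> nodes C \<Longrightarrow> g n = label C n"
  shows "eval_circuit (C\<lparr>label := g\<rparr>) \<sigma> \<longleftrightarrow> eval_circuit C \<tau>"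
proof -
  have val: "lit_val \<sigma> l = lit_val \<tau> l" if "lit_var l \<in> V" for l
    using that assms(2) by (cases l) auto
  \<comment> \<open>The \<open>id\<close> makes the node map of \<open>holds_embed\<close> visible
    to unification.\<close>
  have "holds (C\<lparr>label := g\<rparr>) \<sigma> (id (root C)) \<longleftrightarrow> holds C \<tau> (root C)"
    by (rule holds_embed[where D = "nodes C"])
      (use assms(1,3) val in \<open>auto simp: circuit_over_def is_circuit_def children_def\<close>)
  then show ?thesis by (simp add: eval_circuit_def)
qed

text \<open>Labels of gates count as gates without children, which makes \<open>eval_leaf\<close> unconditional.\<close>

fun label_val :: "('v \<Rightarrow> bool) \<Rightarrow> 'v label \<Rightarrow> bool" where
  "label_val \<sigma> And = True"
| "label_val \<sigma> Or = False"
| "label_val \<sigma> (Lit l) = lit_val \<sigma> l"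
| "label_val \<sigma> (Const b) = b"

lemma eval_leaf: "eval_circuit ((leaf_circuit lab)\<lparr>label := g\<rparr>) \<sigma> \<longleftrightarrow> label_val \<sigma> (g Top)"
  by (cases "g Top")
    (auto simp: eval_circuit_def leaf_circuit_def children_def
      holds_And_iff holds_Or_iff holds_Lit_iff holds_Const_iff)

text \<open>A labelling of a composed circuit is pushed down to an operand by composing it with the
  tag of that operand. All edges are copied along with their tags, so the embedding works with
  \<open>D = UNIV\<close>.\<close>

lemma eval_base: "eval_circuit ((base_circuit C)\<lparr>label := g\<rparr>) \<sigma> \<longleftrightarrow>
    eval_circuit (C\<lparr>label := g \<circ> Base\<rparr>) \<sigma>"
  unfolding eval_circuit_def
  by (simp add: base_circuit_def, rule holds_embed[where D = UNIV])
    (auto simp: children_def)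

lemma holds_gate:
  "holds ((gate_circuit lab A B)\<lparr>label := g\<rparr>) \<sigma> (InL n) \<longleftrightarrow> holds (A\<lparr>label := g \<circ> InL\<rparr>) \<sigma> n"
  "holds ((gate_circuit lab A B)\<lparr>label := g\<rparr>) \<sigma> (InR m) \<longleftrightarrow> holds (B\<lparr>label := g \<circ> InR\<rparr>) \<sigma> m"
  by (rule holds_embed[where D = UNIV]; auto simp: children_def gate_circuit_def)+

lemma children_gate_Top:
  "children ((gate_circuit lab A B)\<lparr>label := g\<rparr>) Top = {InL (root A), InR (root B)}"
  by (auto simp: children_def gate_circuit_def)

text \<open>The kind of gate is read off from \<open>g Top\<close>, because the update overwrites
  \<open>lab\<close>.\<close>

lemma eval_gate:
  shows eval_and_circuit: "g Top = And \<Longrightarrow>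
      eval_circuit ((gate_circuit lab A B)\<lparr>label := g\<rparr>) \<sigma> \<longleftrightarrow>
      eval_circuit (A\<lparr>label := g \<circ> InL\<rparr>) \<sigma> \<and> eval_circuit (B\<lparr>label := g \<circ> InR\<rparr>) \<sigma>"
    and eval_or_circuit: "g Top = Or \<Longrightarrow>
      eval_circuit ((gate_circuit lab A B)\<lparr>label := g\<rparr>) \<sigma> \<longleftrightarrow>
      eval_circuit (A\<lparr>label := g \<circ> InL\<rparr>) \<sigma> \<or> eval_circuit (B\<lparr>label := g \<circ> InR\<rparr>) \<sigma>"
proof -
  have root: "root ((gate_circuit lab A B)\<lparr>label := g\<rparr>) = Top"
    by (simp add: gate_circuit_def)
  show "g Top = And \<Longrightarrow> eval_circuit ((gate_circuit lab A B)\<lparr>label := g\<rparr>) \<sigma> \<longleftrightarrow>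
      eval_circuit (A\<lparr>label := g \<circ> InL\<rparr>) \<sigma> \<and> eval_circuit (B\<lparr>label := g \<circ> InR\<rparr>) \<sigma>"
    unfolding eval_circuit_def root
    by (simp add: holds_And_iff children_gate_Top holds_gate)
  show "g Top = Or \<Longrightarrow> eval_circuit ((gate_circuit lab A B)\<lparr>label := g\<rparr>) \<sigma> \<longleftrightarrow>
      eval_circuit (A\<lparr>label := g \<circ> InL\<rparr>) \<sigma> \<or> eval_circuit (B\<lparr>label := g \<circ> InR\<rparr>) \<sigma>"
    unfolding eval_circuit_def root
    by (simp add: holds_Or_iff children_gate_Top holds_gate)
qed

lemma gate_circuit_simps [simp]:
  "nodes (gate_circuit lab A B) = {Top} \<union> InL ` nodes A \<union> InR ` nodes B"
  "label (gate_circuit lab A B) Top = lab"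
  "label (gate_circuit lab A B) (InL n) = label A n"
  "label (gate_circuit lab A B) (InR n) = label B n"
  by (simp_all add: gate_circuit_def)

lemma leaf_circuit_simps [simp]:
  "nodes (leaf_circuit lab) = {Top}" "label (leaf_circuit lab) n = lab"
  by (simp_all add: leaf_circuit_def)

lemma base_circuit_simps [simp]:
  "nodes (base_circuit C) = Base ` nodes C" "label (base_circuit C) (Base n) = label C n"
  by (simp_all add: base_circuit_def)

section \<open>The conjuncts of a large conjunction\<close>

text \<open>\<open>conjunct m i\<close> embeds the nodes of the \<open>i\<close>-th of \<open>m\<close> conjuncts into \<open>big_and_circuit\<close>.\<close>

fun conjunct :: "nat \<Rightarrow> nat \<Rightarrow> 'n node \<Rightarrow> 'n node" where
  "conjunct (Suc (Suc m)) 0 = InL"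
| "conjunct (Suc (Suc m)) (Suc i) = InR \<circ> conjunct (Suc m) i"
| "conjunct _ _ = id"

text \<open>The tags \<open>InL\<close> and \<open>InR\<close> are injective with disjoint ranges.
  This is what later keeps the leaves of different conjuncts apart.\<close>

lemma conjunct_eq_iff:
  "i < m \<Longrightarrow> j < m \<Longrightarrow> conjunct m i a = conjunct m j b \<longleftrightarrow> i = j \<and> a = b"
proof (induction m i arbitrary: j rule: conjunct.induct)
  case (1 m)
  then show ?case by (cases j) auto
next
  case (2 m i)
  then show ?case by (cases j) auto
qed auto

lemma conjunct_big_and:
  assumes "i < length Cs"
  shows label_conjunct: "label (big_and_circuit Cs) (conjunct (length Cs) i a) = label (Cs ! i) a"
    and conjunct_in_nodes: "conjunct (length Cs) i a \<in> nodes (big_and_circuit Cs) \<longleftrightarrow> a \<in> nodes (Cs ! i)"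
  using assms
proof (induction Cs arbitrary: i rule: big_and_circuit.induct)
  case (3 C D Cs)
  case 1
  with 3 show ?case by (cases i) auto
next
  case (3 C D Cs)
  case 2
  with 3 show ?case by (cases i) auto
qed auto

text \<open>The connecting gates of the conjunction have no names of their own, so the premise
  protects every \<open>And\<close> node; leaves may still be relabelled.\<close>

lemma eval_big_and:
  assumes "\<And>n. n \<in> nodes (big_and_circuit Cs) \<Longrightarrow> label (big_and_circuit Cs) n = And \<Longrightarrow> g n = And"
    and "Cs \<noteq> []"
  shows "eval_circuit ((big_and_circuit Cs)\<lparr>label := g\<rparr>) \<sigma> \<longleftrightarrow>
    (\<forall>i < length Cs. eval_circuit ((Cs ! i)\<lparr>label := g \<circ> conjunct (length Cs) i\<rparr>) \<sigma>)"
  using assms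
proof (induction Cs arbitrary: g rule: big_and_circuit.induct)
  case (3 C D Cs)
  have top: "g Top = And" by (rule 3(2)) auto
  have "eval_circuit ((big_and_circuit (D # Cs))\<lparr>label := g \<circ> InR\<rparr>) \<sigma> \<longleftrightarrow>
    (\<forall>i < length (D # Cs). eval_circuit
        (((D # Cs) ! i)\<lparr>label := (g \<circ> InR) \<circ> conjunct (length (D # Cs)) i\<rparr>) \<sigma>)"
    by (rule 3(1)) (auto intro!: 3(2))
  then show ?case
    using top by (simp add: eval_and_circuit All_less_Suc2 comp_def)
qed auto

section \<open>Well-formedness of composed circuits\<close>

lemma circuit_over_mono: "circuit_over V C \<Longrightarrow> V \<subseteq> W \<Longrightarrow> circuit_over W C"
  by (auto simp: circuit_over_def)

text \<open>The number of proper descendants. It drops along the edges of a finite acyclic graph,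
  and ranks of the parts are combined into a rank on a composed circuit to show that it is
  acyclic.\<close>

definition edge_rank :: "('a \<times> 'a) set \<Rightarrow> 'a \<Rightarrow> nat" where
  "edge_rank r a = card (r\<^sup>+ `` {a})"

lemma edge_rank_less:
  assumes "finite r" and "acyclic r" and "(a, b) \<in> r"
  shows "edge_rank r b < edge_rank r a"
  unfolding edge_rank_def
proof (rule psubset_card_mono)
  have "finite (r\<^sup>+)" using assms(1) by simp
  then show "finite (r\<^sup>+ `` {a})" by (rule finite_Image)
  have "b \<in> r\<^sup>+ `` {a}" "b \<notin> r\<^sup>+ `` {b}"
    using assms by (auto simp: acyclic_def)
  moreover have "r\<^sup>+ `` {b} \<subseteq> r\<^sup>+ `` {a}"
    using assms(3) by (auto intro: trancl_into_trancl2)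
  ultimately show "r\<^sup>+ `` {b} \<subset> r\<^sup>+ `` {a}" by blast
qed

text \<open>The order \<open>s\<close> is kept general because leaf replacement uses a lexicographic
  rank.\<close>

lemma acyclic_if_decreasing:
  assumes "wf s" and "\<And>a b. (a, b) \<in> r \<Longrightarrow> (f b, f a) \<in> s"
  shows "acyclic r"
proof -
  have "wf (r\<inverse>)"
    by (rule wf_subset[OF wf_inv_image[OF assms(1), of f]]) (auto simp: assms(2))
  then have "acyclic (r\<inverse>)" by (rule wf_acyclic)
  then show ?thesis by simp
qed

lemma circuit_edge_rank_less:
  assumes "is_circuit C" and "(m, n) \<in> edges C"
  shows "edge_rank (edges C) n < edge_rank (edges C) m"
proof (rule edge_rank_less[OF _ _ assms(2)])
  show "finite (edges C)"
    using assms(1) by (auto simp: is_circuit_def intro: finite_subset)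
qed (use assms(1) in \<open>simp add: is_circuit_def\<close>)

lemma rtrancl_map_edges:
  assumes "(m, n) \<in> r\<^sup>*" and "\<And>a b. (a, b) \<in> r \<Longrightarrow> (f a, f b) \<in> s"
  shows "(f m, f n) \<in> s\<^sup>*"
  using assms(1) by (induction) (auto intro: rtrancl_into_rtrancl assms(2))

text \<open>Injectivity keeps the two children of a gate distinct, so the arity condition survives
  copying.\<close>

lemma is_circuit_embedded_children:
  assumes "is_circuit C" and "n \<in> nodes C" and "inj_on f (nodes C)"
    and "label A (f n) = label C n" and "children A (f n) = f ` children C n"
  shows "if label A (f n) \<in> {And, Or} then card (children A (f n)) = 2 else children A (f n) = {}"
proof -
  have "children C n \<subseteq> nodes C"
    using assms(1) by (auto simp: is_circuit_def children_def)
  then have "card (f ` children C n) = card (children C n)"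
    by (intro card_image inj_on_subset[OF assms(3)])
  moreover have "if label C n \<in> {And, Or} then card (children C n) = 2 else children C n = {}"
    using assms(1,2) by (simp add: is_circuit_def)
  ultimately show ?thesis
    using assms(4,5) by (simp split: if_splits)
qed

lemma circuit_over_leaf:
  assumes "lab \<notin> {And, Or}" and "\<And>l. lab = Lit l \<Longrightarrow> lit_var l \<in> V"
  shows "circuit_over V (leaf_circuit lab)"
  using assms
  by (auto simp: circuit_over_def is_circuit_def leaf_circuit_def children_def acyclic_def)

lemma circuit_over_base:
  assumes "circuit_over V C"
  shows "circuit_over V (base_circuit C)"
proof -
  have C: "is_circuit C" using assms by (simp add: circuit_over_def)
  have children: "children (base_circuit C) (Base n) = Base ` children C n" for n
    by (auto simp: children_def base_circuit_def)
  have "is_circuit (base_circuit C)"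
    unfolding is_circuit_def
  proof (intro conjI ballI)
    show "finite (nodes (base_circuit C))" "root (base_circuit C) \<in> nodes (base_circuit C)"
      "edges (base_circuit C) \<subseteq> nodes (base_circuit C) \<times> nodes (base_circuit C)"
      using C by (auto simp: is_circuit_def base_circuit_def)
    show "acyclic (edges (base_circuit C))"
      by (rule acyclic_if_decreasing[OF wf_less,
            where f = "\<lambda>a. case a of Base n \<Rightarrow> edge_rank (edges C) n | _ \<Rightarrow> 0"])
        (use circuit_edge_rank_less[OF C] in \<open>auto simp: base_circuit_def\<close>)
  next
    fix a assume "a \<in> nodes (base_circuit C)"
    then obtain n where n: "a = Base n" "n \<in> nodes C" by auto
    have "(root C, n) \<in> (edges C)\<^sup>*" using C n by (simp add: is_circuit_def)
    then have "(Base (root C), Base n) \<in> (edges (base_circuit C))\<^sup>*"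
      by (rule rtrancl_map_edges) (auto simp: base_circuit_def)
    then show "(root (base_circuit C), a) \<in> (edges (base_circuit C))\<^sup>*"
      by (simp add: n base_circuit_def)
    show "if label (base_circuit C) a \<in> {And, Or} then card (children (base_circuit C) a) = 2
        else children (base_circuit C) a = {}"
      unfolding n(1) by (rule is_circuit_embedded_children[OF C n(2)]) (auto simp: children inj_on_def)
  qed
  then show ?thesis using assms by (auto simp: circuit_over_def)
qed

lemma circuit_over_gate:
  assumes "circuit_over V A" and "circuit_over V B" and "lab \<in> {And, Or}"
  shows "circuit_over V (gate_circuit lab A B)"
proof -
  let ?C = "gate_circuit lab A B"
  have A: "is_circuit A" and B: "is_circuit B" using assms by (simp_all add: circuit_over_def)
  have children: "children ?C (InL n) = InL ` children A n" "children ?C (InR n) = InR ` children B n"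
    for n
    by (auto simp: children_def gate_circuit_def)
  have root: "root ?C = Top" by (simp add: gate_circuit_def)
  have "is_circuit ?C"
    unfolding is_circuit_def
  proof (intro conjI ballI)
    show "finite (nodes ?C)" "root ?C \<in> nodes ?C" "edges ?C \<subseteq> nodes ?C \<times> nodes ?C"
      using A B by (auto simp: is_circuit_def gate_circuit_def)
    \<comment> \<open>The new root gets a rank above those of both operand roots.\<close>
    let ?f = "\<lambda>a. case a of InL n \<Rightarrow> edge_rank (edges A) n | InR n \<Rightarrow> edge_rank (edges B) n
      | _ \<Rightarrow> Suc (edge_rank (edges A) (root A) + edge_rank (edges B) (root B))"
    show "acyclic (edges ?C)"
      by (rule acyclic_if_decreasing[OF wf_less, where f = ?f])
        (use circuit_edge_rank_less[OF A] circuit_edge_rank_less[OF B] in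
          \<open>auto simp: gate_circuit_def\<close>)
  next
    fix a assume "a \<in> nodes ?C"
    then consider "a = Top" | n where "a = InL n" "n \<in> nodes A" | n where "a = InR n" "n \<in> nodes B"
      by auto
    then have "(Top, a) \<in> (edges ?C)\<^sup>* \<and>
      (if label ?C a \<in> {And, Or} then card (children ?C a) = 2 else children ?C a = {})"
    proof cases
      case 1
      have "children ?C Top = {InL (root A), InR (root B)}"
        by (auto simp: children_def gate_circuit_def)
      with 1 show ?thesis using assms(3) by simp
    next
      case 2
      have "(root A, n) \<in> (edges A)\<^sup>*" using A 2 by (simp add: is_circuit_def)
      then have "(InL (root A), InL n) \<in> (edges ?C)\<^sup>*"
        by (rule rtrancl_map_edges) (auto simp: gate_circuit_def)
      moreover have "(Top, InL (root A)) \<in> edges ?C" by (simp add: gate_circuit_def)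
      moreover have "if label ?C (InL n) \<in> {And, Or} then card (children ?C (InL n)) = 2
          else children ?C (InL n) = {}"
        by (rule is_circuit_embedded_children[OF A 2(2)]) (auto simp: children inj_on_def)
      ultimately show ?thesis using 2 by (auto intro: converse_rtrancl_into_rtrancl)
    next
      case 3
      have "(root B, n) \<in> (edges B)\<^sup>*" using B 3 by (simp add: is_circuit_def)
      then have "(InR (root B), InR n) \<in> (edges ?C)\<^sup>*"
        by (rule rtrancl_map_edges) (auto simp: gate_circuit_def)
      moreover have "(Top, InR (root B)) \<in> edges ?C" by (simp add: gate_circuit_def)
      moreover have "if label ?C (InR n) \<in> {And, Or} then card (children ?C (InR n)) = 2
          else children ?C (InR n) = {}"
        by (rule is_circuit_embedded_children[OF B 3(2)]) (auto simp: children inj_on_def)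
      ultimately show ?thesis using 3 by (auto intro: converse_rtrancl_into_rtrancl)
    qed
    then show "(root ?C, a) \<in> (edges ?C)\<^sup>*"
      "if label ?C a \<in> {And, Or} then card (children ?C a) = 2 else children ?C a = {}"
      unfolding root by (rule conjunct1, rule conjunct2)
  qed
  then show ?thesis using assms by (auto simp: circuit_over_def)
qed

lemma circuit_over_big_and:
  "(\<And>C. C \<in> set Cs \<Longrightarrow> circuit_over V C) \<Longrightarrow> circuit_over V (big_and_circuit Cs)"
  by (induction Cs rule: big_and_circuit.induct)
    (auto intro!: circuit_over_leaf circuit_over_gate)

section \<open>Replacing leaves by circuits\<close>

lemma replaced_node_eq_iff: "replaced_node G \<rho> m = replaced_node G \<rho> n \<longleftrightarrow> m = n"
  by (auto simp: replaced_node_def split: option.splits)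

lemma children_replace_Base:
  assumes "replacement G \<rho> n = None"
  shows "children (replace_leaves G \<rho>) (Base n) = replaced_node G \<rho> ` children G n"
  using assms
  by (fastforce simp: children_def replace_leaves_def replaced_node_def split: option.splits)

text \<open>Only literal nodes are replaced, and these are leaves of \<open>G\<close>. Hence no edge
  inherited from \<open>G\<close> starts at the root of an inserted copy, whose children are then
  exactly those inside the copy.\<close>

lemma replacement_no_children:
  assumes "is_circuit G" and "replacement G \<rho> n = Some C"
  shows "(n, m) \<notin> edges G"
proof
  assume edge: "(n, m) \<in> edges G"
  then have "n \<in> nodes G" "children G n \<noteq> {}"
    using assms(1) by (auto simp: is_circuit_def children_def)
  moreover have "label G n \<notin> {And, Or}"
    using assms(2) by (auto simp: replacement_def)
  ultimately show False
    using assms(1) by (auto simp: is_circuit_def)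
qed

lemma children_replace_At:
  assumes "is_circuit G" and "replacement G \<rho> n = Some C" and "n \<in> nodes G"
  shows "children (replace_leaves G \<rho>) (At n p) = At n ` children C p"
  using assms replacement_no_children[OF assms(1,2)]
  by (auto simp: children_def replace_leaves_def replaced_node_def split: option.splits)

lemma circuit_over_replace_leaves:
  assumes "circuit_over V G"
    and \<rho>: "\<And>l C. \<rho> l = Some C \<Longrightarrow> circuit_over W C"
    and VW: "\<And>l. lit_var l \<in> V \<Longrightarrow> \<rho> l = None \<Longrightarrow> lit_var l \<in> W"
  shows "circuit_over W (replace_leaves G \<rho>)"
proof -
  let ?R = "replace_leaves G \<rho>"
  have G: "is_circuit G" using assms(1) by (simp add: circuit_over_def)
  have C: "circuit_over W C" "is_circuit C" if "replacement G \<rho> n = Some C" for n C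
    using that \<rho> by (auto simp: replacement_def circuit_over_def split: label.splits)
  have root_in: "root C \<in> nodes C" if "replacement G \<rho> n = Some C" for n C
    using C[OF that] by (simp add: is_circuit_def)
  have replaced_in: "replaced_node G \<rho> n \<in> nodes ?R" if "n \<in> nodes G" for n
    using that root_in
    by (auto simp: replace_leaves_def replaced_node_def split: option.splits)
  have nodes_cases: thesis
    if "a \<in> nodes ?R"
      "\<And>n. a = Base n \<Longrightarrow> n \<in> nodes G \<Longrightarrow> replacement G \<rho> n = None \<Longrightarrow> thesis"
      "\<And>n p D. a = At n p \<Longrightarrow> n \<in> nodes G \<Longrightarrow> replacement G \<rho> n = Some D \<Longrightarrow> p \<in> nodes D \<Longrightarrow> thesis"
    for a thesis
    using that by (auto simp: replace_leaves_def)
  have label_Base: "label ?R (Base n) = label G n" for n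
    by (simp add: replace_leaves_def)
  have label_At: "label ?R (At n p) = label D p" if "replacement G \<rho> n = Some D" for n p D
    using that by (simp add: replace_leaves_def)
  \<comment> \<open>A path in \<open>G\<close> survives with each replaced leaf turned into the root
    of its copy; the interior of a copy is reached from that root.\<close>
  have reach: "(root ?R, replaced_node G \<rho> n) \<in> (edges ?R)\<^sup>*" if "n \<in> nodes G" for n
  proof -
    have "(root G, n) \<in> (edges G)\<^sup>*" using G that by (simp add: is_circuit_def)
    then have "(replaced_node G \<rho> (root G), replaced_node G \<rho> n) \<in> (edges ?R)\<^sup>*"
      by (rule rtrancl_map_edges) (auto simp: replace_leaves_def)
    then show ?thesis by (simp add: replace_leaves_def)
  qed
  have "is_circuit ?R"
    unfolding is_circuit_def
  proof (intro conjI ballI)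
    have "nodes ?R \<subseteq> Base ` nodes G \<union>
        (\<Union>n \<in> nodes G. case replacement G \<rho> n of None \<Rightarrow> {} | Some C \<Rightarrow> At n ` nodes C)"
      by (fastforce elim!: nodes_cases)
    moreover have "finite (nodes G)" using G by (simp add: is_circuit_def)
    moreover have "finite (case replacement G \<rho> n of None \<Rightarrow> {} | Some C \<Rightarrow> At n ` nodes C)" for n
      using C(2) by (auto simp: is_circuit_def split: option.splits)
    ultimately show "finite (nodes ?R)"
      by (meson finite_UN_I finite_UnI finite_imageI finite_subset)
    have "root ?R = replaced_node G \<rho> (root G)" by (simp add: replace_leaves_def)
    then show "root ?R \<in> nodes ?R"
      using G replaced_in by (simp add: is_circuit_def)
    show "edges ?R \<subseteq> nodes ?R \<times> nodes ?R"
    proof (intro subrelI)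
      fix a b assume "(a, b) \<in> edges ?R"
      then consider m n where "a = replaced_node G \<rho> m" "b = replaced_node G \<rho> n" "(m, n) \<in> edges G"
        | n p q D where "a = At n p" "b = At n q" "n \<in> nodes G" "replacement G \<rho> n = Some D"
            "(p, q) \<in> edges D"
        by (auto simp: replace_leaves_def)
      then show "(a, b) \<in> nodes ?R \<times> nodes ?R"
      proof cases
        case 1
        then show ?thesis using G replaced_in by (auto simp: is_circuit_def)
      next
        case 2
        then show ?thesis using C(2)[of n D] by (auto simp: is_circuit_def replace_leaves_def)
      qed
    qed
    \<comment> \<open>Lexicographic rank: edges coming from \<open>G\<close> lower the first
      component, while edges inside a copy keep it and lower the second. The last case is a default
      for names that do not occur.\<close>
    let ?f = "\<lambda>a. case a of Base n \<Rightarrow> (edge_rank (edges G) n, 0)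
      | At n p \<Rightarrow> (edge_rank (edges G) n, edge_rank (edges (the (replacement G \<rho> n))) p)
      | _ \<Rightarrow> (0, 0)"
    have "fst (?f (replaced_node G \<rho> n)) = edge_rank (edges G) n" for n
      by (auto simp: replaced_node_def split: option.splits)
    then have "(?f (replaced_node G \<rho> n), ?f (replaced_node G \<rho> m)) \<in> less_than <*lex*> less_than"
      if "(m, n) \<in> edges G" for m n
      using circuit_edge_rank_less[OF G that] by (simp add: lex_prod_def case_prod_beta)
    then show "acyclic (edges ?R)"
      by (intro acyclic_if_decreasing[where f = ?f and s = "less_than <*lex*> less_than"])
        (use circuit_edge_rank_less[OF C(2)] in \<open>auto simp: replace_leaves_def\<close>)
  next
    fix a assume "a \<in> nodes ?R"
    then show "(root ?R, a) \<in> (edges ?R)\<^sup>*"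
    proof (rule nodes_cases)
      fix n assume "a = Base n" "n \<in> nodes G" "replacement G \<rho> n = None"
      then show ?thesis using reach[of n] by (simp add: replaced_node_def)
    next
      fix n p D assume a: "a = At n p" "n \<in> nodes G" "replacement G \<rho> n = Some D" "p \<in> nodes D"
      have "(root D, p) \<in> (edges D)\<^sup>*" using C(2)[OF a(3)] a(4) by (simp add: is_circuit_def)
      then have "(At n (root D), At n p) \<in> (edges ?R)\<^sup>*"
        by (rule rtrancl_map_edges) (use a in \<open>auto simp: replace_leaves_def\<close>)
      moreover have "(root ?R, At n (root D)) \<in> (edges ?R)\<^sup>*"
        using reach[OF a(2)] a(3) by (simp add: replaced_node_def)
      ultimately show ?thesis unfolding a(1) by (rule rtrancl_trans[rotated])
    qed
  next
    fix a assume "a \<in> nodes ?R"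
    then show "if label ?R a \<in> {And, Or} then card (children ?R a) = 2 else children ?R a = {}"
    proof (rule nodes_cases)
      fix n assume n: "a = Base n" "n \<in> nodes G" "replacement G \<rho> n = None"
      then have a: "a = replaced_node G \<rho> n" by (simp add: replaced_node_def)
      show ?thesis
        unfolding a
        by (rule is_circuit_embedded_children[OF G n(2)])
          (use n in \<open>auto simp: inj_on_def replaced_node_eq_iff label_Base children_replace_Base a[symmetric]\<close>)
    next
      fix n p D assume a: "a = At n p" "n \<in> nodes G" "replacement G \<rho> n = Some D" "p \<in> nodes D"
      show ?thesis
        unfolding a(1)
        by (rule is_circuit_embedded_children[OF C(2)[OF a(3)] a(4)])
          (use a in \<open>auto simp: inj_on_def label_At children_replace_At[OF G]\<close>)
    qed
  qed
  moreover have "lit_var l \<in> W" if "a \<in> nodes ?R" "label ?R a = Lit l" for a l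
    using that(1)
  proof (rule nodes_cases)
    fix n assume n: "a = Base n" "n \<in> nodes G" "replacement G \<rho> n = None"
    then have "label G n = Lit l" using that(2) by (simp add: label_Base)
    with n assms(1) VW show ?thesis by (auto simp: replacement_def circuit_over_def)
  next
    fix n p D assume a: "a = At n p" "n \<in> nodes G" "replacement G \<rho> n = Some D" "p \<in> nodes D"
    with that(2) C(1)[OF a(3)] show ?thesis by (auto simp: label_At circuit_over_def)
  qed
  ultimately show ?thesis by (simp add: circuit_over_def)
qed

text \<open>The substitution lemma for circuits. \<open>replaced_node\<close> transfers values from
  \<open>G\<close>: gates recurse, kept leaves agree by \<open>None\<close>, and a replaced leaf is
  mapped to the root of a copy whose value is given by \<open>Some\<close>.\<close>

lemma eval_replace_leaves:
  assumes G: "is_circuit G"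
    and None: "\<And>l. \<rho> l = None \<Longrightarrow> lit_val \<sigma> l = lit_val \<tau> l"
    and Some: "\<And>l C. \<rho> l = Some C \<Longrightarrow> eval_circuit C \<sigma> = lit_val \<tau> l"
  shows "eval_circuit (replace_leaves G \<rho>) \<sigma> \<longleftrightarrow> eval_circuit G \<tau>"
proof -
  let ?R = "replace_leaves G \<rho>"
  \<comment> \<open>Each inserted copy is closed under children, so it evaluates like the circuit it
    copies.\<close>
  have At: "holds ?R \<sigma> (At n p) \<longleftrightarrow> holds C \<sigma> p"
    if "n \<in> nodes G" "replacement G \<rho> n = Some C" for n p C
    using children_replace_At[OF G that(2,1)]
    by (intro holds_embed[where D = UNIV]) (use that in \<open>auto simp: replace_leaves_def\<close>)
  have "holds ?R \<sigma> (replaced_node G \<rho> (root G)) \<longleftrightarrow> holds G \<tau> (root G)"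
  proof (rule holds_transfer[where D = "nodes G"])
    show "root G \<in> nodes G" using G by (simp add: is_circuit_def)
    fix n assume n: "n \<in> nodes G"
    show "(holds ?R \<sigma> (replaced_node G \<rho> n) \<longleftrightarrow> holds G \<tau> n) \<or>
      (label G n \<in> {And, Or} \<and> label ?R (replaced_node G \<rho> n) = label G n \<and>
       children ?R (replaced_node G \<rho> n) = replaced_node G \<rho> ` children G n \<and>
       children G n \<subseteq> nodes G)"
    proof (cases "replacement G \<rho> n")
      case None': None
      then have rn: "replaced_node G \<rho> n = Base n" by (simp add: replaced_node_def)
      have lab: "label ?R (Base n) = label G n" by (simp add: replace_leaves_def)
      have sub: "children G n \<subseteq> nodes G"
        using G by (auto simp: is_circuit_def children_def)
      show ?thesis
      proof (cases "label G n")
        case (Lit l)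
        with None' have "\<rho> l = None" by (simp add: replacement_def)
        then show ?thesis using None Lit lab rn by (simp add: holds_Lit_iff)
      qed (use lab rn sub None' in \<open>auto simp: holds_Const_iff children_replace_Base\<close>)
    next
      case (Some C)
      then obtain l where l: "label G n = Lit l" "\<rho> l = Some C"
        by (auto simp: replacement_def split: label.splits)
      have "replaced_node G \<rho> n = At n (root C)" using Some by (simp add: replaced_node_def)
      then show ?thesis
        using At[OF n Some] assms(3)[OF l(2)] l(1) by (simp add: eval_circuit_def holds_Lit_iff)
    qed
  qed
  then show ?thesis by (simp add: eval_circuit_def replace_leaves_def)
qed

section \<open>The graph of the Skolem functions\<close>

text \<open>The \<open>x\<^sub>i\<close>-leaf and the \<open>\<not>x\<^sub>i\<close>-leaf of \<open>skolem_graph_circuit\<close> are numbered \<open>2 * i\<close> and \<open>2 * i + 1\<close>.\<close>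

definition graph_leaf :: "nat \<Rightarrow> nat \<Rightarrow> 'n node" where
  "graph_leaf m j = conjunct m (j div 2) (if even j then InL (InL Top) else InR (InL Top))"

definition graph_lit :: "'v list \<Rightarrow> nat \<Rightarrow> 'v lit" where
  "graph_lit Xs j = (if even j then Pos (Xs ! (j div 2)) else Neg (Xs ! (j div 2)))"

lemma graph_leaf_eq_iff:
  assumes "i < 2 * m" and "j < 2 * m"
  shows "graph_leaf m i = graph_leaf m j \<longleftrightarrow> i = j"
proof -
  have "i div 2 < m" "j div 2 < m" using assms by auto
  moreover have "i div 2 = j div 2 \<Longrightarrow> even i = even j \<Longrightarrow> i = j" by presburger
  ultimately show ?thesis
    by (auto simp: graph_leaf_def conjunct_eq_iff)
qed

lemma graph_lit_eq_iff:
  assumes "distinct Xs" and "i < 2 * length Xs" and "j < 2 * length Xs"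
  shows "graph_lit Xs i = graph_lit Xs j \<longleftrightarrow> i = j"
proof -
  have "i div 2 < length Xs" "j div 2 < length Xs" using assms by auto
  moreover have "i div 2 = j div 2 \<Longrightarrow> even i = even j \<Longrightarrow> i = j" by presburger
  ultimately show ?thesis
    using assms(1) by (auto simp: graph_lit_def nth_eq_iff_index_eq)
qed

text \<open>The two leaves of a conjunct have neighbouring numbers. An odd \<open>j\<close> is
  positive, so \<open>j - 1\<close> does not truncate.\<close>

lemma lit_neg_graph_lit: "lit_neg (graph_lit Xs j) = graph_lit Xs (if even j then j + 1 else j - 1)"
  by (auto simp: graph_lit_def elim: oddE)

lemma lit_var_graph_lit: "j < 2 * length Xs \<Longrightarrow> lit_var (graph_lit Xs j) \<in> set Xs"
  by (auto simp: graph_lit_def)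

definition graph_conjunct ::
    "'v list \<Rightarrow> ('n, 'v) circuit list \<Rightarrow> ('n, 'v) circuit list \<Rightarrow> nat \<Rightarrow> ('n node, 'v) circuit" where
  "graph_conjunct Xs \<Psi> N i = or_circuit
     (and_circuit (leaf_circuit (Lit (Pos (Xs ! i)))) (base_circuit (\<Psi> ! i)))
     (and_circuit (leaf_circuit (Lit (Neg (Xs ! i)))) (base_circuit (N ! i)))"

lemma skolem_graph_circuit_eq:
  "skolem_graph_circuit Xs \<Psi> N = big_and_circuit (map (graph_conjunct Xs \<Psi> N) [0..<length Xs])"
  by (simp add: skolem_graph_circuit_def graph_conjunct_def[abs_def])

lemma conjunct_skolem_graph:
  assumes "i < length Xs"
  shows "label (skolem_graph_circuit Xs \<Psi> N) (conjunct (length Xs) i a) =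
      label (graph_conjunct Xs \<Psi> N i) a"
    and "conjunct (length Xs) i a \<in> nodes (skolem_graph_circuit Xs \<Psi> N) \<longleftrightarrow>
      a \<in> nodes (graph_conjunct Xs \<Psi> N i)"
  using assms label_conjunct[where Cs = "map (graph_conjunct Xs \<Psi> N) [0..<length Xs]" and i = i]
    conjunct_in_nodes[where Cs = "map (graph_conjunct Xs \<Psi> N) [0..<length Xs]" and i = i]
  by (simp_all add: skolem_graph_circuit_eq)

lemma graph_leaf_skolem_graph:
  assumes "j < 2 * length Xs"
  shows "graph_leaf (length Xs) j \<in> lit_leaves (skolem_graph_circuit Xs \<Psi> N) (graph_lit Xs j)"
proof -
  have "j div 2 < length Xs" using assms by auto
  then show ?thesis
    by (auto simp: lit_leaves_def graph_leaf_def graph_lit_def conjunct_skolem_graph graph_conjunct_def)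
qed

lemma circuit_over_skolem_graph:
  assumes "\<And>i. i < length Xs \<Longrightarrow> circuit_over W (\<Psi> ! i)" and "\<And>i. i < length Xs \<Longrightarrow> circuit_over W (N ! i)"
  shows "circuit_over (W \<union> set Xs) (skolem_graph_circuit Xs \<Psi> N)"
  unfolding skolem_graph_circuit_def
  by (rule circuit_over_big_and)
    (auto intro!: circuit_over_gate circuit_over_leaf circuit_over_base
      intro: circuit_over_mono[OF assms(1)] circuit_over_mono[OF assms(2)])

text \<open>The condition on \<open>g\<close> fixes gates, constants and literals over
  \<open>W\<close>, hence the copies of \<open>\<Psi> ! i\<close> and \<open>N ! i\<close> entirely.
  Only the two graph leaves of each conjunct can be relabelled, so their labels stay as parameters
  of the formula.\<close>

lemma eval_skolem_graph:
  assumes "Xs \<noteq> []"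
    and over: "\<And>i. i < length Xs \<Longrightarrow> circuit_over W (\<Psi> ! i)" "\<And>i. i < length Xs \<Longrightarrow> circuit_over W (N ! i)"
    and g: "\<And>n. n \<in> nodes (skolem_graph_circuit Xs \<Psi> N) \<Longrightarrow>
      (\<And>l. label (skolem_graph_circuit Xs \<Psi> N) n = Lit l \<Longrightarrow> lit_var l \<in> W) \<Longrightarrow>
      g n = label (skolem_graph_circuit Xs \<Psi> N) n"
  shows "eval_circuit ((skolem_graph_circuit Xs \<Psi> N)\<lparr>label := g\<rparr>) \<sigma> \<longleftrightarrow>
    (\<forall>i < length Xs.
       label_val \<sigma> (g (graph_leaf (length Xs) (2 * i))) \<and> eval_circuit (\<Psi> ! i) \<sigma> \<or>
       label_val \<sigma> (g (graph_leaf (length Xs) (2 * i + 1))) \<and> eval_circuit (N ! i) \<sigma>)"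
proof -
  let ?m = "length Xs"
  let ?D = "graph_conjunct Xs \<Psi> N"
  let ?Cs = "map ?D [0..<?m]"
  have gD: "g (conjunct ?m i a) = label (?D i) a"
    if "i < ?m" "a \<in> nodes (?D i)" "\<And>l. label (?D i) a = Lit l \<Longrightarrow> lit_var l \<in> W" for i a
    using g[of "conjunct ?m i a"] that by (simp add: conjunct_skolem_graph)
  have "eval_circuit ((?D i)\<lparr>label := g \<circ> conjunct ?m i\<rparr>) \<sigma> \<longleftrightarrow>
       label_val \<sigma> (g (graph_leaf ?m (2 * i))) \<and> eval_circuit (\<Psi> ! i) \<sigma> \<or>
       label_val \<sigma> (g (graph_leaf ?m (2 * i + 1))) \<and> eval_circuit (N ! i) \<sigma>"
    if i: "i < ?m" for i
  proof -
    let ?h = "g \<circ> conjunct ?m i"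
    have top: "?h Top = Or" "?h (InL Top) = And" "?h (InR Top) = And"
      using gD[OF i, of Top] gD[OF i, of "InL Top"] gD[OF i, of "InR Top"] by (auto simp: graph_conjunct_def)
    have *: "eval_circuit ((\<Psi> ! i)\<lparr>label := ?h \<circ> InL \<circ> InR \<circ> Base\<rparr>) \<sigma> \<longleftrightarrow> eval_circuit (\<Psi> ! i) \<sigma>"
      using over(1)[OF i]
      by (rule eval_circuit_cong)
        (use gD[OF i, of "InL (InR (Base _))"] over(1)[OF i] in \<open>auto simp: graph_conjunct_def circuit_over_def\<close>)
    have **: "eval_circuit ((N ! i)\<lparr>label := ?h \<circ> InR \<circ> InR \<circ> Base\<rparr>) \<sigma> \<longleftrightarrow> eval_circuit (N ! i) \<sigma>"
      using over(2)[OF i]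
      by (rule eval_circuit_cong)
        (use gD[OF i, of "InR (InR (Base _))"] over(2)[OF i] in \<open>auto simp: graph_conjunct_def circuit_over_def\<close>)
    have "eval_circuit ((?D i)\<lparr>label := ?h\<rparr>) \<sigma> \<longleftrightarrow>
       label_val \<sigma> (?h (InL (InL Top))) \<and> eval_circuit ((\<Psi> ! i)\<lparr>label := ?h \<circ> InL \<circ> InR \<circ> Base\<rparr>) \<sigma> \<or>
       label_val \<sigma> (?h (InR (InL Top))) \<and> eval_circuit ((N ! i)\<lparr>label := ?h \<circ> InR \<circ> InR \<circ> Base\<rparr>) \<sigma>"
      unfolding graph_conjunct_def using top
      by (simp add: eval_or_circuit eval_and_circuit eval_leaf eval_base)
    then show ?thesis by (simp only: * **) (simp add: graph_leaf_def)
  qed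
  moreover have "eval_circuit ((big_and_circuit ?Cs)\<lparr>label := g\<rparr>) \<sigma> \<longleftrightarrow>
      (\<forall>i < length ?Cs. eval_circuit ((?Cs ! i)\<lparr>label := g \<circ> conjunct (length ?Cs) i\<rparr>) \<sigma>)"
    \<comment> \<open>An \<open>And\<close> node carries no literal, so the condition on
      \<open>g\<close> protects it.\<close>
    by (rule eval_big_and) (use assms(1) g[unfolded skolem_graph_circuit_eq] in \<open>force, simp\<close>)
  ultimately show ?thesis by (simp add: skolem_graph_circuit_eq)
qed

section \<open>Unrealizability of the leaves of the graph\<close>

text \<open>Merges four nested relabellings into one case distinction: \<open>A\<close> to true, the
  other \<open>l\<close>-leaves to false, \<open>p\<close> to \<open>w\<close>, the leaves of the
  negated literal to \<open>w'\<close>. Earlier tests take precedence because a leaf set to a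
  constant no longer carries a literal.\<close>

lemma and_realizable_set_singleton_iff:
  assumes "p \<in> lit_leaves H l" and "p \<notin> A"
  shows "and_realizable_set (relabel H A True) l {p} \<longleftrightarrow>
    (\<exists>\<sigma>. \<forall>w w'. eval_circuit (H\<lparr>label := \<lambda>n.
        if n \<in> A then Const True
        else if n = p then Const w
        else if n \<in> lit_leaves H l then Const False
        else if n \<in> lit_leaves H (lit_neg l) then Const w'
        else label H n\<rparr>) \<sigma> = (w \<and> w'))"
proof -
  have "lit_neg l \<noteq> l" by (cases l) auto
  then have "relabel_lit (relabel_lit (relabel (relabel H A True)
        (lit_leaves (relabel H A True) l - {p}) False) l w) (lit_neg l) w' =
      H\<lparr>label := \<lambda>n.
        if n \<in> A then Const True
        else if n = p then Const w
        else if n \<in> lit_leaves H l then Const False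
        else if n \<in> lit_leaves H (lit_neg l) then Const w'
        else label H n\<rparr>" for w w'
    using assms
    by (auto simp: relabel_lit_def relabel_def lit_leaves_def fun_eq_iff intro!: circuit.equality)
  then show ?thesis by (simp add: and_realizable_set_def and_realizable_def)
qed

text \<open>\<open>B\<close> and \<open>K\<close> stand for the copy of \<open>G\<close> and for
  \<open>G'\<close>. The argument rests on the shape of the circuit, on \<open>N ! i\<close>
  negating \<open>\<Psi> ! i\<close>, and on \<open>K\<close> being free of outputs.\<close>

lemma saunf_skolem_graph:
  fixes \<Psi> N :: "('n, 'v) circuit list" and B :: "('n node, 'v) circuit"
  assumes Xs: "distinct Xs" "Xs \<noteq> []" and W: "W \<inter> set Xs = {}"
    and over: "\<And>i. i < length Xs \<Longrightarrow> circuit_over W (\<Psi> ! i)" "\<And>i. i < length Xs \<Longrightarrow> circuit_over W (N ! i)"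
    and neg: "\<And>i \<sigma>. i < length Xs \<Longrightarrow> eval_circuit (N ! i) \<sigma> \<longleftrightarrow> \<not> eval_circuit (\<Psi> ! i) \<sigma>"
    and K: "circuit_over W K"
  shows "\<exists>S. saunf (set Xs) (and_circuit (or_circuit (skolem_graph_circuit Xs \<Psi> N) B) K) S"
proof -
  let ?m = "length Xs"
  define F where "F = skolem_graph_circuit Xs \<Psi> N"
  define H where "H = and_circuit (or_circuit F B) K"
  \<comment> \<open>\<open>F\<close> is the left operand of the left operand of \<open>H\<close>,
    hence the two tags.\<close>
  define leaf :: "nat \<Rightarrow> 'n node" where "leaf j = InL (InL (graph_leaf ?m j))" for j
  define S where "S = map (\<lambda>j. {leaf j}) [0..<2 * ?m]"
  have len: "length S = 2 * ?m" and nth: "j < 2 * ?m \<Longrightarrow> S ! j = {leaf j}" for j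
    by (simp_all add: S_def)
  have take: "\<Union> (set (take j S)) = leaf ` {..<j}" if "j \<le> 2 * ?m" for j
    using that by (auto simp: S_def take_map)
  have leaf_eq: "leaf i = leaf j \<longleftrightarrow> i = j" if "i < 2 * ?m" "j < 2 * ?m" for i j
    using that by (simp add: leaf_def graph_leaf_eq_iff)
  have leaf_in: "leaf j \<in> lit_leaves H (graph_lit Xs j)" if "j < 2 * ?m" for j
    using graph_leaf_skolem_graph[OF that, of \<Psi> N] by (auto simp: lit_leaves_def H_def F_def leaf_def)
  \<comment> \<open>As the outputs are distinct, each output literal labels exactly one graph leaf.
    Setting the remaining leaves of a literal to false therefore spares the other leaves of
    \<open>F\<close>.\<close>
  have leaf_in_iff: "leaf i \<in> lit_leaves H (graph_lit Xs j) \<longleftrightarrow> i = j"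
    if "i < 2 * ?m" "j < 2 * ?m" for i j
    using leaf_in[OF that(1)] graph_lit_eq_iff[OF Xs(1) that] by (auto simp: lit_leaves_def)
  \<comment> \<open>One formula for every relabelling that touches only output leaves; it serves the
    unrealizability steps as well as the final independence.\<close>
  have eval_H: "eval_circuit (H\<lparr>label := g\<rparr>) \<sigma> \<longleftrightarrow>
      ((\<forall>i < ?m. label_val \<sigma> (g (leaf (2 * i))) \<and> eval_circuit (\<Psi> ! i) \<sigma> \<or>
               label_val \<sigma> (g (leaf (2 * i + 1))) \<and> \<not> eval_circuit (\<Psi> ! i) \<sigma>) \<or>
       eval_circuit (B\<lparr>label := g \<circ> InL \<circ> InR\<rparr>) \<sigma>) \<and> eval_circuit K \<sigma>"
    if g: "\<And>n. n \<in> nodes H \<Longrightarrow> (\<And>l. label H n = Lit l \<Longrightarrow> lit_var l \<notin> set Xs) \<Longrightarrow> g n = label H n"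
    for g \<sigma>
  proof -
    have top: "g Top = And" "g (InL Top) = Or"
      using g[of Top] g[of "InL Top"] by (simp_all add: H_def)
    have gK: "g (InR n) = label K n" if "n \<in> nodes K" for n
      using g[of "InR n"] that(1) K W by (force simp: H_def circuit_over_def)
    have gF: "g (InL (InL n)) = label F n"
      if "n \<in> nodes F" "\<And>l. label F n = Lit l \<Longrightarrow> lit_var l \<in> W" for n
      using g[of "InL (InL n)"] that W by (force simp: H_def)
    have "eval_circuit (K\<lparr>label := g \<circ> InR\<rparr>) \<sigma> \<longleftrightarrow> eval_circuit K \<sigma>"
      using K by (rule eval_circuit_cong)
        (simp_all add: gK)
    moreover have "eval_circuit (F\<lparr>label := g \<circ> InL \<circ> InL\<rparr>) \<sigma> \<longleftrightarrow>
      (\<forall>i < ?m. label_val \<sigma> (g (leaf (2 * i))) \<and> eval_circuit (\<Psi> ! i) \<sigma> \<or>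
               label_val \<sigma> (g (leaf (2 * i + 1))) \<and> eval_circuit (N ! i) \<sigma>)"
      unfolding F_def
      by (subst eval_skolem_graph[where W = W])
        (use Xs(2) over gF in \<open>auto simp: F_def leaf_def\<close>)
    ultimately show ?thesis
      using top neg by (simp add: H_def eval_and_circuit eval_or_circuit)
  qed
  have unrealizable: "\<not> and_realizable_set (relabel H (leaf ` {..<j}) True) (graph_lit Xs j) {leaf j}"
    if j: "j < 2 * ?m" for j
  proof -
    let ?l = "graph_lit Xs j"
    \<comment> \<open>The other leaf of the same conjunct. For even \<open>j\<close> it stays in
      range because the bound \<open>2 * ?m\<close> is even.\<close>
    define j' where "j' = (if even j then j + 1 else j - 1)"
    have j': "j' < 2 * ?m" using j by (cases "even j") (auto simp: j'_def elim!: evenE)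
    have neg_l: "lit_neg ?l = graph_lit Xs j'" by (simp add: lit_neg_graph_lit j'_def)
    \<comment> \<open>The labelling of \<open>and_realizable_set_singleton_iff\<close> with the
      earlier leaves as \<open>A\<close> and the current leaf as \<open>p\<close>.\<close>
    define g where "g w w' n = (if n \<in> leaf ` {..<j} then Const True
        else if n = leaf j then Const w
        else if n \<in> lit_leaves H ?l then Const False
        else if n \<in> lit_leaves H (lit_neg ?l) then Const w'
        else label H n)" for w w' n
    have g_H: "g w w' n = label H n"
      if "n \<in> nodes H" "\<And>l. label H n = Lit l \<Longrightarrow> lit_var l \<notin> set Xs" for w w' n
    proof -
      have no_lit: "n \<notin> lit_leaves H (graph_lit Xs i)" if "i < 2 * ?m" for i
        using \<open>\<And>l. label H n = Lit l \<Longrightarrow> lit_var l \<notin> set Xs\<close> lit_var_graph_lit[OF that]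
        by (auto simp: lit_leaves_def)
      then have "n \<noteq> leaf i" if "i < 2 * ?m" for i
        using leaf_in[OF that] that by blast
      then have "n \<notin> leaf ` {..<j}" "n \<noteq> leaf j" using j less_trans[OF _ j] by blast+
      then show ?thesis
        using no_lit[OF j] no_lit[OF j'] by (simp add: g_def neg_l)
    qed
    have before: "g w w' (leaf i) = Const True" if "i < j" for i w w'
      using that by (simp add: g_def)
    have here: "g w w' (leaf j) = Const w" for w w'
      using j leaf_eq by (auto simp: g_def)
    \<comment> \<open>For odd \<open>j\<close> the complementary leaf has number
      \<open>j - 1\<close>; it is already true and is covered by \<open>before\<close>.\<close>
    have succ: "g w w' (leaf (j + 1)) = Const w'" if "even j" for w w'
    proof -
      have "j + 1 < 2 * ?m" "j' = j + 1" using that j' by (simp_all add: j'_def)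
      then show ?thesis
        using j leaf_eq leaf_in_iff by (auto simp: g_def neg_l)
    qed
    have after: "g w w' (leaf i) = label H (leaf i)"
      if "j < i" "i div 2 \<noteq> j div 2" "i < 2 * ?m" for i w w'
    proof -
      have "i \<noteq> j'" using that by (auto simp: j'_def)
      then show ?thesis
        using that j j' leaf_eq leaf_in_iff by (auto simp: g_def neg_l)
    qed
    \<comment> \<open>The argument \<open>True\<close> is a dummy: the leaf carrying
      \<open>w\<close> lies in \<open>F\<close>, so the labelling of the \<open>B\<close>-part
      ignores \<open>w\<close>.\<close>
    define h where "h w' = g True w' \<circ> InL \<circ> InR" for w'
    have B: "g w w' \<circ> InL \<circ> InR = h w'" for w w'
      by (auto simp: h_def g_def leaf_def fun_eq_iff)
    show ?thesis
    proof
      assume "and_realizable_set (relabel H (leaf ` {..<j}) True) ?l {leaf j}"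
      moreover have "leaf j \<notin> leaf ` {..<j}" using j leaf_eq by auto
      ultimately have "\<exists>\<sigma>. \<forall>w w'. eval_circuit (H\<lparr>label := \<lambda>n. g w w' n\<rparr>) \<sigma> = (w \<and> w')"
        unfolding g_def by (subst (asm) and_realizable_set_singleton_iff[OF leaf_in[OF j]])
      then obtain \<sigma> where \<sigma>: "eval_circuit (H\<lparr>label := g w w'\<rparr>) \<sigma> \<longleftrightarrow> w \<and> w'" for w w'
        by blast
      define P where "P w w' i \<longleftrightarrow>
          label_val \<sigma> (g w w' (leaf (2 * i))) \<and> eval_circuit (\<Psi> ! i) \<sigma> \<or>
          label_val \<sigma> (g w w' (leaf (2 * i + 1))) \<and> \<not> eval_circuit (\<Psi> ! i) \<sigma>" for w w' i
      have eval: "w \<and> w' \<longleftrightarrow> ((\<forall>i < ?m. P w w' i) \<or>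
          eval_circuit (B\<lparr>label := h w'\<rparr>) \<sigma>) \<and> eval_circuit K \<sigma>" for w w'
        using eval_H[of "g w w'" \<sigma>] g_H \<sigma>[of w w'] unfolding P_def B by blast
      \<comment> \<open>The \<open>B\<close>-part has the same value at both points. Falsity at
        \<open>(False, True)\<close> makes it false there, so truth at \<open>(True, True)\<close>
        must come from \<open>F\<close>.\<close>
      from eval[of True True] eval[of False True]
      have K: "eval_circuit K \<sigma>" and P11: "\<And>i. i < ?m \<Longrightarrow> P True True i"
        and P01: "\<not> (\<forall>i < ?m. P False True i)"
        by auto
      \<comment> \<open>Leaves of earlier conjuncts are already true and those of later conjuncts
        keep their literals, so neither \<open>w\<close> nor \<open>w'\<close> reaches them. The
        failure at \<open>(False, True)\<close> is thus located in the current conjunct.\<close>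
      have const: "P w w' i \<longleftrightarrow> P True True i" if "i < ?m" "i \<noteq> j div 2" for w w' i
      proof (cases "i < j div 2")
        case True
        then have "2 * i < j" "2 * i + 1 < j" by auto
        then show ?thesis by (simp add: P_def before)
      next
        case False
        then have "j < 2 * i" "j < 2 * i + 1" using that by auto
        then show ?thesis using that by (simp add: P_def after)
      qed
      have i: "j div 2 < ?m" using j by auto
      have notP: "\<not> P False True (j div 2)" using P01 P11 const by blast
      have "P True False (j div 2)"
      proof (cases "even j")
        case True
        then show ?thesis using notP here succ by (auto simp: P_def)
      next
        case False
        then have "j = 2 * (j div 2) + 1" by simp
        then show ?thesis
          using here before[of "2 * (j div 2)"] by (auto simp: P_def)
      qed
      then have "\<forall>i < ?m. P True False i" using P11 const by blast
      then show False using eval[of True False] K by blast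
    qed
  qed
  have "saunf (set Xs) H S"
    unfolding saunf_def
  proof (intro conjI allI impI)
    show "S \<noteq> []" using Xs(2) by (simp add: S_def)
  next
    fix i j assume "i < length S" "j < length S" "i \<noteq> j"
    then show "S ! i \<inter> S ! j = {}" using leaf_eq by (auto simp: len nth)
  next
    fix j assume "j < length S"
    then have j: "j < 2 * ?m" by (simp add: len)
    show "\<exists>l. lit_var l \<in> set Xs \<and> S ! j \<noteq> {} \<and> S ! j \<subseteq> lit_leaves H l \<and>
        \<not> and_realizable_set (relabel H (\<Union> (set (take j S))) True) l (S ! j)"
      using lit_var_graph_lit[OF j] leaf_in[OF j] unrealizable[OF j] j
      by (intro exI[of _ "graph_lit Xs j"]) (simp add: nth take)
  next
    define g where "g n = (if n \<in> leaf ` {..<2 * ?m} then Const True else label H n)" for n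
    have U: "\<Union> (set S) = leaf ` {..<2 * ?m}" using take[of "2 * ?m"] by (simp add: len)
    have "g n = label H n" if "n \<in> nodes H" "\<And>l. label H n = Lit l \<Longrightarrow> lit_var l \<notin> set Xs" for n
      using that leaf_in lit_var_graph_lit by (fastforce simp: g_def lit_leaves_def)
    moreover have "relabel H (\<Union> (set S)) True = H\<lparr>label := g\<rparr>"
      by (simp add: relabel_def U g_def[abs_def])
    moreover have "g (leaf (2 * i)) = Const True" "g (leaf (2 * i + 1)) = Const True" if "i < ?m" for i
      using that by (auto simp: g_def)
    \<comment> \<open>With both graph leaves true, each conjunct is an instance of excluded middle;
      \<open>F\<close> is true and absorbs \<open>B\<close>.\<close>
    ultimately have eval: "eval_circuit (relabel H (\<Union> (set S)) True) \<sigma> \<longleftrightarrow> eval_circuit K \<sigma>" for \<sigma>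
      by (simp add: eval_H)
    have "eval_circuit K \<sigma> \<longleftrightarrow> eval_circuit K \<tau>" if "\<forall>v. v \<notin> set Xs \<longrightarrow> \<sigma> v = \<tau> v" for \<sigma> \<tau>
      using eval_circuit_cong[OF K, of \<sigma> \<tau> "label K"] that W by auto
    then show "independent_of (set Xs) (relabel H (\<Union> (set S)) True)"
      by (simp add: independent_of_def eval)
  qed
  then show ?thesis unfolding H_def F_def by blast
qed

section \<open>Equivalence of \<open>H\<close> and \<open>G\<close>, and assembly of the
  result\<close>

theorem theorem3:
  fixes Is Xs :: "'v list"
    and G :: "('n, 'v) circuit"
    and \<Psi> N :: "('n, 'v) circuit list"
    and F G' H :: "('n node, 'v) circuit"
  assumes "distinct Is" and "distinct Xs" and "set Is \<inter> set Xs = {}" and "Xs \<noteq> []"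
    and "circuit_over (set Is \<union> set Xs) G"
    and "skolem_vector Is Xs G \<Psi>"
    and "negation_vector Is \<Psi> N"
    and "G' = skolem_subst_circuit G Xs \<Psi> N"
    and "F = skolem_graph_circuit Xs \<Psi> N"
    and "H = and_circuit (or_circuit F (base_circuit G)) G'"
  shows "circuit_over (set Is \<union> set Xs) H \<and>
    (\<exists>S. saunf (set Xs) H S) \<and>
    (\<forall>\<sigma>. eval_circuit G \<sigma> \<longleftrightarrow> eval_circuit H \<sigma>)"
proof -
  let ?m = "length Xs"
  have len: "length \<Psi> = ?m" "length N = ?m"
    using assms(6,7) by (auto simp: skolem_vector_def negation_vector_def dest: list_all2_lengthD)
  have over: "circuit_over (set Is) (\<Psi> ! i)" "circuit_over (set Is) (N ! i)"
    and neg: "eval_circuit (N ! i) \<sigma> \<longleftrightarrow> \<not> eval_circuit (\<Psi> ! i) \<sigma>" if "i < ?m" for i \<sigma>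
    using assms(6,7) that len
    by (auto simp: skolem_vector_def negation_vector_def list_all2_conv_all_nth)
  have skolem: "eval_circuit G (subst_assignment Xs \<Psi> \<sigma>) \<longleftrightarrow>
      (\<exists>\<tau>. (\<forall>v. v \<notin> set Xs \<longrightarrow> \<tau> v = \<sigma> v) \<and> eval_circuit G \<tau>)" for \<sigma>
    using assms(6) by (simp add: skolem_vector_def)
  have map_of_None: "map_of (zip Xs Cs) v = None \<longleftrightarrow> v \<notin> set Xs"
    if "length Cs = ?m" for Cs :: "('n, 'v) circuit list" and v
    using that by (simp add: map_of_zip_is_None)
  have map_of_Some: "\<exists>i < ?m. v = Xs ! i \<and> C = Cs ! i"
    if "map_of (zip Xs Cs) v = Some C" for Cs :: "('n, 'v) circuit list" and v C
    using map_of_SomeD[OF that] by (auto simp: set_zip)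
  have map_of_nth: "map_of (zip Xs Cs) (Xs ! i) = Some (Cs ! i)"
    if "length Cs = ?m" "i < ?m" for Cs :: "('n, 'v) circuit list" and i
    using that assms(2) by (simp add: map_of_zip_nth)
  let ?\<rho> = "skolem_replacement Xs \<Psi> N"
  have \<rho>_None: "?\<rho> l = None \<longleftrightarrow> lit_var l \<notin> set Xs" for l
    by (cases l) (simp_all add: map_of_None len)
  have overG': "circuit_over (set Is) G'"
    unfolding assms(8) skolem_subst_circuit_def
  proof (rule circuit_over_replace_leaves[OF assms(5)])
    fix l C assume "?\<rho> l = Some C"
    then show "circuit_over (set Is) C"
      using over by (cases l) (auto dest!: map_of_Some)
  qed (auto simp: \<rho>_None)
  \<comment> \<open>The substitution lemma with \<open>subst_assignment Xs \<Psi> \<sigma>\<close>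
    as the assignment for \<open>G\<close>; negative literals are covered because \<open>N\<close>
    negates \<open>\<Psi>\<close>.\<close>
  have evalG': "eval_circuit G' \<sigma> \<longleftrightarrow> eval_circuit G (subst_assignment Xs \<Psi> \<sigma>)" for \<sigma>
    unfolding assms(8) skolem_subst_circuit_def
  proof (rule eval_replace_leaves)
    show "is_circuit G" using assms(5) by (simp add: circuit_over_def)
  next
    fix l assume "?\<rho> l = None"
    then have "subst_assignment Xs \<Psi> \<sigma> (lit_var l) = \<sigma> (lit_var l)"
      using len by (simp add: \<rho>_None subst_assignment_def map_of_zip_is_None[THEN iffD2])
    then show "lit_val \<sigma> l = lit_val (subst_assignment Xs \<Psi> \<sigma>) l"
      by (cases l) auto
  next
    fix l C assume "?\<rho> l = Some C"
    then show "eval_circuit C \<sigma> = lit_val (subst_assignment Xs \<Psi> \<sigma>) l"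
      by (cases l) (auto dest!: map_of_Some simp: subst_assignment_def map_of_nth len neg)
  qed
  have evalF: "eval_circuit F \<sigma> \<longleftrightarrow> (\<forall>i < ?m. \<sigma> (Xs ! i) = eval_circuit (\<Psi> ! i) \<sigma>)" for \<sigma>
  proof -
    have lab: "label F (graph_leaf ?m j) = Lit (graph_lit Xs j)" if "j < 2 * ?m" for j
      using graph_leaf_skolem_graph[OF that] by (auto simp: assms(9) lit_leaves_def)
    \<comment> \<open>The trivial update brings \<open>F\<close> into the form required by
      \<open>eval_skolem_graph\<close>. With the literals in place, each conjunct says that an
      output equals its Skolem value.\<close>
    have "eval_circuit (F\<lparr>label := label F\<rparr>) \<sigma> \<longleftrightarrow> (\<forall>i < ?m.
       label_val \<sigma> (label F (graph_leaf ?m (2 * i))) \<and> eval_circuit (\<Psi> ! i) \<sigma> \<or>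
       label_val \<sigma> (label F (graph_leaf ?m (2 * i + 1))) \<and> eval_circuit (N ! i) \<sigma>)"
      unfolding assms(9) by (rule eval_skolem_graph) (use assms(4) over in auto)
    then show ?thesis by (auto simp: lab graph_lit_def neg)
  qed
  have eval_H: "eval_circuit H \<sigma> \<longleftrightarrow> (eval_circuit F \<sigma> \<or> eval_circuit G \<sigma>) \<and> eval_circuit G' \<sigma>" for \<sigma>
  proof -
    have comp: "label (gate_circuit lab A B) \<circ> InL = label A" "label (gate_circuit lab A B) \<circ> InR = label B"
      "label (base_circuit C) \<circ> Base = label C" for lab and A B :: "('n node, 'v) circuit" and C :: "('n, 'v) circuit"
      by auto
    have gates: "eval_circuit (and_circuit A B) \<sigma> \<longleftrightarrow> eval_circuit A \<sigma> \<and> eval_circuit B \<sigma>"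
      "eval_circuit (or_circuit A B) \<sigma> \<longleftrightarrow> eval_circuit A \<sigma> \<or> eval_circuit B \<sigma>"
      for A B :: "('n node, 'v) circuit"
      using eval_and_circuit[of "label (and_circuit A B)" And A B \<sigma>]
        eval_or_circuit[of "label (or_circuit A B)" Or A B \<sigma>] by (simp_all add: comp)
    show ?thesis
      using eval_base[where C = G and g = "label (base_circuit G)" and \<sigma> = \<sigma>] by (simp add: assms(10) gates comp)
  qed
  have "eval_circuit G \<sigma> \<longleftrightarrow> eval_circuit H \<sigma>" for \<sigma>
  proof -
    \<comment> \<open>On the graph of the Skolem functions the substitution fixes \<sigma>, so
      \<open>G'\<close> and \<open>G\<close> agree there.\<close>
    have "subst_assignment Xs \<Psi> \<sigma> = \<sigma>" if "eval_circuit F \<sigma>"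
      using that
      by (auto simp: evalF fun_eq_iff subst_assignment_def dest!: map_of_Some split: option.splits)
    \<comment> \<open>If \<open>G\<close> holds at \<sigma>, then \<sigma> itself witnesses the
      existential and \<open>G'\<close> holds, hence \<open>H\<close>. Conversely, \<open>H\<close>
      gives either \<open>G\<close> directly or \<open>F\<close> together with \<open>G'\<close>,
      where the previous fact applies.\<close>
    then show ?thesis using skolem[of \<sigma>] by (auto simp: eval_H evalG')
  qed
  moreover have "circuit_over (set Is \<union> set Xs) H"
    unfolding assms(9,10)
    by (intro circuit_over_gate circuit_over_skolem_graph circuit_over_base over assms(5)
        circuit_over_mono[OF overG']) auto
  moreover have "\<exists>S. saunf (set Xs) H S"
    unfolding assms(9,10)
    by (rule saunf_skolem_graph[OF assms(2,4,3) over neg overG'])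
  ultimately show ?thesis by blast
qed

end
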